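(* Let $A_1-\lambda B_1$ be a regular pencil of complex $n\times n$ matrices such that no eigenvalue of the pencil lies in $S_\infty$, i.e. $S_\infty\cap\lambda(A_1,B_1)=\emptyset$. Let $\{A_k-\lambda B_k\}_{k\ge 1}$ be the sequence of matrix pencils obtained from $A_1-\lambda B_1$ by the iteration $$A_k=A_1(A_1+B_{k-1})^{-1}A_{k-1},\qquad B_k=B_{k-1}(A_1+B_{k-1})^{-1}B_1,\qquad k\ge 2 .$$ Then for any two positive integers $i$ and $j$ (the inverses below existing) $$A_{i+j}=A_i(A_i+B_j)^{-1}A_j,\qquad B_{i+j}=B_j(A_i+B_j)^{-1}B_i .$$
   Context: A pencil $A-\lambda B$ of $n\times n$ complex matrices is regular if $\det(A-\lambda B)$ is not identically zero in $\lambda$. $\lambda(A,B)\subset\mathbb{C}\cup\{\infty\}$ denotes the set of eigenvalues of the pencil: $\mu\in\mathbb{C}$ is an eigenvalue iff $\det(A-\mu B)=0$, and $\infty$ is an eigenvalue iff $\det B=0$. For $k\ge1$, $S_k=\bigcup_{2\le p\le k+1}\{e^{2q\pi \mathrm{i}/p}:1\le q\le p-1\}$ and $S_\infty=\bigcup_{k\ge1}S_k$, i.e. the set of all roots of unity other than $1$. Under the hypothesis $S_\infty\cap\lambda(A_1,B_1)=\emptyset$ all inverses in the iteration exist. *)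

theory Defs
  imports "HOL-Analysis.Analysis"
begin

definition pencil_at :: "complex^'n^'n \<Rightarrow> complex^'n^'n \<Rightarrow> complex \<Rightarrow> complex^'n^'n" where
  "pencil_at A B \<mu> = A - map_matrix (\<lambda>x. \<mu> * x) B"

definition regular_pencil :: "complex^'n^'n \<Rightarrow> complex^'n^'n \<Rightarrow> bool" where
  "regular_pencil A B \<longleftrightarrow> (\<exists>\<mu>. det (pencil_at A B \<mu>) \<noteq> 0)"

(* The extended plane is modelled by the option type: Some \<mu> is the finite number \<mu>,
   and None is the point at infinity. *)
definition pencil_eigenvalues :: "complex^'n^'n \<Rightarrow> complex^'n^'n \<Rightarrow> complex option set" where
  "pencil_eigenvalues A B =
     {Some \<mu> | \<mu>. det (pencil_at A B \<mu>) = 0} \<union> {z. z = None \<and> det B = 0}"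

definition S :: "nat \<Rightarrow> complex set" where
  "S k = (\<Union>p\<in>{2..k+1}. {exp (2 * of_nat q * of_real pi * \<i> / of_nat p) | q. 1 \<le> q \<and> q \<le> p - 1})"

definition S_inf :: "complex set" where
  "S_inf = (\<Union>k\<in>{1..}. S k)"

end

(* Pick \<mu> with C = A 1 - \<mu> B 1 invertible and put Q = B 1 C^{-1}, P = A 1 C^{-1} = 1 + \<mu> Q, which
   commute. With s k = \<Sum>m<k. P^m Q^(k-1-m), the iteration has the closed form
   A k = P^k (s k)^{-1} C and B k = Q^k (s k)^{-1} C, and everything follows from
   P^i s j + Q^j s i = s (i+j). Each s k is a polynomial in Q. It is invertible because its
   roots z satisfy 1 + \<mu> z = \<omega> z with \<omega>^k = 1 and \<omega> \<noteq> 1, so that the linear factor Q - z is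
   proportional to P - \<omega> Q = (A 1 - \<omega> B 1) C^{-1}. *)

theory Submission
  imports Defs "HOL-Computational_Algebra.Fundamental_Theorem_Algebra"
begin

section \<open>Homogeneous geometric sums\<close>

text \<open>This is (x^n - y^n) / (x - y) written without division, so that it also makes sense for
  x = y. The general ring allows both polynomials and their values as arguments.\<close>

definition hom_geometric_sum :: "'a::comm_ring_1 \<Rightarrow> 'a \<Rightarrow> nat \<Rightarrow> 'a" where
  "hom_geometric_sum x y n = (\<Sum>m<n. y ^ (n - Suc m) * x ^ m)"

lemma hom_geometric_sum_1 [simp]: "hom_geometric_sum x y (Suc 0) = 1"
  by (simp add: hom_geometric_sum_def)

lemma diff_mult_hom_geometric_sum: "(x - y) * hom_geometric_sum x y n = x ^ n - y ^ n"
  by (simp add: hom_geometric_sum_def power_diff_sumr2)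

lemma hom_geometric_sum_Suc:
  "hom_geometric_sum x y (Suc n) = x ^ n + y * hom_geometric_sum x y n"
proof -
  have "(\<Sum>m<n. y ^ (n - m) * x ^ m) = y * (\<Sum>m<n. y ^ (n - Suc m) * x ^ m)"
    unfolding sum_distrib_left
  proof (rule sum.cong)
    fix m assume "m \<in> {..<n}"
    then have "n - m = Suc (n - Suc m)" by auto
    then show "y ^ (n - m) * x ^ m = y * (y ^ (n - Suc m) * x ^ m)"
      by (simp add: mult.assoc)
  qed simp
  then show ?thesis by (simp add: hom_geometric_sum_def)
qed

text \<open>Multiplied by x - y, both sides become x^(i+j) - y^(i+j). That factor cannot be
  cancelled in a general commutative ring, hence the induction.\<close>

lemma hom_geometric_sum_add:
  "hom_geometric_sum x y (i + j) = x ^ i * hom_geometric_sum x y j + y ^ j * hom_geometric_sum x y i"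
proof (induction i)
  case 0
  then show ?case by (simp add: hom_geometric_sum_def)
next
  case (Suc i)
  \<comment> \<open>Trading a factor x for y costs only x^j - y^j.\<close>
  have "x * hom_geometric_sum x y j = x ^ j - y ^ j + y * hom_geometric_sum x y j"
    using diff_mult_hom_geometric_sum[of x y j] by (simp add: algebra_simps)
  then have "x ^ Suc i * hom_geometric_sum x y j
      = x ^ i * (x ^ j - y ^ j + y * hom_geometric_sum x y j)"
    by (metis mult.left_commute mult.assoc power_Suc)
  then show ?case
    using Suc.IH by (simp add: hom_geometric_sum_Suc algebra_simps power_add)
qed

lemma poly_hom_geometric_sum:
  "poly (hom_geometric_sum p q n) z = hom_geometric_sum (poly p z) (poly q z) n"
  by (simp add: hom_geometric_sum_def poly_sum)

text \<open>The ratio x / y is an n-th root of unity because x^n = y^n. It is not 1, since for x = y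
  the sum is n y^(n-1), which is nonzero.\<close>

lemma hom_geometric_sum_eq_0_imp:
  fixes x y :: complex
  assumes "hom_geometric_sum x y n = 0" "y \<noteq> 0" "n > 0"
  obtains \<omega> where "x = \<omega> * y" "\<omega> ^ n = 1" "\<omega> \<noteq> 1"
proof
  show "x = (x / y) * y" using assms by simp
  have "x ^ n = y ^ n"
    using diff_mult_hom_geometric_sum[of x y n] assms by simp
  then show "(x / y) ^ n = 1" using assms by (simp add: power_divide)
  show "x / y \<noteq> 1"
  proof
    assume "x / y = 1"
    then have "x = y" using assms by simp
    then have "hom_geometric_sum x y n = (\<Sum>m<n. y ^ (n - 1))"
      unfolding hom_geometric_sum_def by (intro sum.cong) (auto simp flip: power_add)
    then show False using assms by simp
  qed
qed

lemma root_of_unity_in_S_inf: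
  assumes "\<omega> ^ n = 1" "\<omega> \<noteq> 1" "n > 0"
  shows "\<omega> \<in> S_inf"
proof -
  have "\<omega> \<in> {exp (2 * of_real pi * \<i> * of_nat q / of_nat n) | q. q < n}"
    using complex_roots_unity[of n] assms by auto
  then obtain q where q: "q < n" "\<omega> = exp (2 * of_real pi * \<i> * of_nat q / of_nat n)" by auto
  have "q \<noteq> 0" using q assms by (cases "q = 0") auto
  then have "1 \<le> q \<and> q \<le> n - 1" "2 \<le> n" using q by auto
  moreover have "\<omega> = exp (2 * of_nat q * of_real pi * \<i> / of_nat n)"
    using q by (simp add: ac_simps)
  \<comment> \<open>\<open>S k\<close> admits denominators p up to k + 1, so p = n is the last one
    in \<open>S (n - 1)\<close>. No reduction to the exact order of \<open>\<omega>\<close> is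
    made.\<close>
  ultimately have "\<omega> \<in> S (n - 1)"
    unfolding S_def by (intro UN_I[of n]) auto
  then show ?thesis using \<open>2 \<le> n\<close> unfolding S_inf_def by (intro UN_I[of "n - 1"]) auto
qed

section \<open>Polynomials evaluated at a matrix\<close>

lemma matrix_add_rdistrib: "(B + C) ** A = B ** A + C ** A"
  by (simp add: vec_eq_iff matrix_matrix_mult_def sum.distrib distrib_right)

lemma mat_matrix_mult: "mat c ** M = map_matrix ((*) c) (M :: 'a::semiring_1^'n^'m)"
  by (simp add: vec_eq_iff matrix_matrix_mult_def mat_def if_distrib if_distribR cong: if_cong)

lemma matrix_mult_mat: "M ** mat c = map_matrix ((*) c) (M :: 'a::comm_semiring_1^'n^'m)"
  by (simp add: vec_eq_iff matrix_matrix_mult_def mat_def if_distrib mult.commute cong: if_cong)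

lemma mat_matrix_mult_commute: "mat c ** M = M ** mat (c :: 'a::comm_semiring_1)"
  by (simp add: mat_matrix_mult matrix_mult_mat)

lemma mat_0: "mat 0 = 0"
  by (simp add: vec_eq_iff mat_def)

lemma mat_add: "mat (a + b :: 'a::monoid_add) = mat a + mat b"
  by (auto simp: vec_eq_iff mat_def)

lemma mat_mult: "mat (a * b) = mat a ** mat b"
  by (simp add: vec_eq_iff mat_matrix_mult) (simp add: mat_def)

text \<open>Horner's scheme, with scalars embedded as the matrices \<open>mat a\<close>.\<close>

definition poly_matrix :: "'a::comm_ring_1^'n^'n \<Rightarrow> 'a poly \<Rightarrow> 'a^'n^'n" where
  "poly_matrix M p = fold_coeffs (\<lambda>a X. mat a + M ** X) p 0"

lemma poly_matrix_0 [simp]: "poly_matrix M 0 = 0"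
  by (simp add: poly_matrix_def)

lemma poly_matrix_pCons: "poly_matrix M (pCons a p) = mat a + M ** poly_matrix M p"
\<comment> \<open>\<open>pCons 0 0\<close> is the zero polynomial, on which the fold performs no
  step.\<close>
proof (cases "p = 0 \<and> a = 0")
  case True
  then show ?thesis by (simp add: mat_0)
next
  case False
  then show ?thesis by (auto simp: poly_matrix_def)
qed

lemma poly_matrix_1 [simp]: "poly_matrix M 1 = mat 1"
  by (simp add: one_pCons poly_matrix_pCons)

lemma poly_matrix_add: "poly_matrix M (p + q) = poly_matrix M p + poly_matrix M q"
  by (induction p q rule: poly_induct2)
    (simp_all add: poly_matrix_pCons mat_add matrix_add_ldistrib)

lemma poly_matrix_smult: "poly_matrix M (smult c p) = mat c ** poly_matrix M p"
proof (induction p)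
  case (pCons a p)
  have "mat c ** (M ** poly_matrix M p) = M ** (mat c ** poly_matrix M p)"
    by (simp only: matrix_mul_assoc mat_matrix_mult_commute[of c M])
  then show ?case using pCons
    by (simp add: poly_matrix_pCons mat_mult matrix_add_ldistrib)
qed simp

lemma poly_matrix_mult: "poly_matrix M (p * q) = poly_matrix M p ** poly_matrix M q"
proof (induction p)
  case (pCons a p)
  then show ?case
    by (simp add: poly_matrix_add poly_matrix_smult poly_matrix_pCons
        matrix_add_rdistrib matrix_mul_assoc mat_0)
qed simp

lemma poly_matrix_commute: "poly_matrix M p ** poly_matrix M q = poly_matrix M q ** poly_matrix M p"
  by (simp add: mult.commute flip: poly_matrix_mult)

lemma invertible_mat: "(c::'a::field) \<noteq> 0 \<Longrightarrow> invertible (mat c)"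
  unfolding invertible_def by (intro exI[of _ "mat (1 / c)"]) (simp flip: mat_mult)

text \<open>Over the complex numbers p splits into linear factors, so its value at M is a nonzero
  scalar times a product of invertible matrices.\<close>

lemma invertible_poly_matrix:
  fixes M :: "complex^'n^'n"
  assumes "p \<noteq> 0" and "\<And>z. poly p z = 0 \<Longrightarrow> invertible (poly_matrix M [:- z, 1:])"
  shows "invertible (poly_matrix M p)"
  using assms
proof (induction "degree p" arbitrary: p)
  case 0
  then obtain c where "p = [:c:]" by (metis degree_eq_zeroE)
  then show ?case using 0 by (auto simp: poly_matrix_pCons invertible_mat)
next
  case (Suc d)
  have "\<not> constant (poly p)" using Suc(2) by (simp add: constant_degree)
  then obtain z where "poly p z = 0" using fundamental_theorem_of_algebra by blast
  then obtain r where r: "p = [:- z, 1:] * r" by (metis poly_eq_0_iff_dvd dvdE)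
  then have "r \<noteq> 0" using Suc.prems by auto
  then have "degree p = Suc (degree r)" unfolding r by (subst degree_mult_eq) auto
  then have "invertible (poly_matrix M r)"
    using Suc \<open>r \<noteq> 0\<close> r by auto
  then show ?case
    using Suc.prems(2)[OF \<open>poly p z = 0\<close>] unfolding r poly_matrix_mult by (simp add: invertible_mult)
qed

section \<open>Rational functions evaluated at a matrix\<close>

lemma
  assumes "invertible M"
  shows matrix_inv_right: "M ** matrix_inv M = mat 1"
    and matrix_inv_left: "matrix_inv M ** M = mat 1"
  using someI_ex[OF assms[unfolded invertible_def]] by (simp_all add: matrix_inv_def)

lemma matrix_inv_unique:
  fixes M N :: "'a::semiring_1^'n^'n"
  assumes "M ** N = mat 1" "N ** M = mat 1"
  shows "matrix_inv M = N"
proof -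
  have "invertible M" using assms invertible_def by blast
  then have "matrix_inv M ** M = mat 1" by (rule matrix_inv_left)
  then show ?thesis by (metis assms(1) matrix_mul_assoc matrix_mul_lid matrix_mul_rid)
qed

text \<open>The value of p / s at M, meaningful when s(M) is invertible. Numerator and denominator
  stay separate arguments so that this invertibility can be tracked.\<close>

definition frac_matrix :: "'a::comm_ring_1^'n^'n \<Rightarrow> 'a poly \<Rightarrow> 'a poly \<Rightarrow> 'a^'n^'n" where
  "frac_matrix M p s = poly_matrix M p ** matrix_inv (poly_matrix M s)"

lemma frac_matrix_unique:
  assumes "invertible (poly_matrix M s)" "X ** poly_matrix M s = poly_matrix M p"
  shows "frac_matrix M p s = X"
  unfolding frac_matrix_def assms(2)[symmetric]
  by (simp add: assms(1) matrix_inv_right flip: matrix_mul_assoc)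

lemma frac_matrix_mult_denominator:
  "invertible (poly_matrix M s) \<Longrightarrow> frac_matrix M p s ** poly_matrix M s = poly_matrix M p"
  unfolding frac_matrix_def by (simp add: matrix_inv_left flip: matrix_mul_assoc)

text \<open>The inverse of s(M) commutes with everything that s(M) commutes with.\<close>

lemma frac_matrix_commute:
  assumes "invertible (poly_matrix M s)"
  shows "frac_matrix M p s ** poly_matrix M q = poly_matrix M q ** frac_matrix M p s"
proof -
  let ?I = "matrix_inv (poly_matrix M s)" and ?s = "poly_matrix M s" and ?q = "poly_matrix M q"
  have "?I ** ?q = ?I ** (?q ** ?s) ** ?I"
    by (simp add: assms matrix_inv_right flip: matrix_mul_assoc)
  also have "\<dots> = (?I ** ?s) ** ?q ** ?I"
    by (simp add: poly_matrix_commute[of M q] matrix_mul_assoc)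
  also have "\<dots> = ?q ** ?I"
    by (simp add: assms matrix_inv_left)
  finally have "?I ** ?q = ?q ** ?I" .
  then show ?thesis
    unfolding frac_matrix_def
    by (metis matrix_mul_assoc poly_matrix_commute)
qed

lemma frac_matrix_mult:
  assumes "invertible (poly_matrix M s)" "invertible (poly_matrix M t)"
  shows "frac_matrix M p s ** frac_matrix M q t = frac_matrix M (p * q) (s * t)"
proof (rule frac_matrix_unique[symmetric])
  show "invertible (poly_matrix M (s * t))"
    using assms by (simp add: poly_matrix_mult invertible_mult)
  have "frac_matrix M p s ** frac_matrix M q t ** poly_matrix M (s * t)
      = frac_matrix M p s ** (frac_matrix M q t ** poly_matrix M t) ** poly_matrix M s"
    by (simp add: poly_matrix_mult poly_matrix_commute[of M s t] matrix_mul_assoc)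
  also have "\<dots> = (frac_matrix M p s ** poly_matrix M q) ** poly_matrix M s"
    by (simp add: frac_matrix_mult_denominator assms)
  also have "\<dots> = poly_matrix M q ** (frac_matrix M p s ** poly_matrix M s)"
    by (simp only: frac_matrix_commute[OF assms(1), of p q] matrix_mul_assoc)
  also have "\<dots> = poly_matrix M (p * q)"
    by (simp add: frac_matrix_mult_denominator assms poly_matrix_mult poly_matrix_commute)
  finally show "frac_matrix M p s ** frac_matrix M q t ** poly_matrix M (s * t)
      = poly_matrix M (p * q)" .
qed

lemma frac_matrix_self: "invertible (poly_matrix M s) \<Longrightarrow> frac_matrix M s s = mat 1"
  by (rule frac_matrix_unique) simp_all

lemma frac_matrix_cancel:
  assumes "invertible (poly_matrix M s)" "invertible (poly_matrix M t)"
  shows "frac_matrix M (p * t) (s * t) = frac_matrix M p s"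
  by (simp add: frac_matrix_self assms flip: frac_matrix_mult)

lemma frac_matrix_add:
  assumes "invertible (poly_matrix M s)" "invertible (poly_matrix M t)"
  shows "frac_matrix M p s + frac_matrix M q t = frac_matrix M (p * t + q * s) (s * t)"
proof -
  have "frac_matrix M p s + frac_matrix M q t
      = frac_matrix M (p * t) (s * t) + frac_matrix M (q * s) (s * t)"
    using assms frac_matrix_cancel[of M s t p] frac_matrix_cancel[of M t s q]
    by (simp add: mult.commute)
  then show ?thesis
    by (simp add: frac_matrix_def poly_matrix_add matrix_add_rdistrib)
qed

text \<open>The reciprocal fraction inverts the fraction. \<open>C\<close> is not assumed to commute
  with \<open>M\<close>, so the order of the factors matters.\<close>

lemma
  fixes M C :: "'a::comm_ring_1^'n^'n"
  assumes "invertible (poly_matrix M p)" "invertible (poly_matrix M s)" "invertible C"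
  shows invertible_frac_matrix_mult: "invertible (frac_matrix M p s ** C)"
    and matrix_inv_frac_matrix_mult:
      "matrix_inv (frac_matrix M p s ** C) = matrix_inv C ** frac_matrix M s p"
proof -
  have *: "frac_matrix M p s ** frac_matrix M s p = mat 1"
    "frac_matrix M s p ** frac_matrix M p s = mat 1"
    using assms by (simp_all add: frac_matrix_mult mult.commute frac_matrix_self
        poly_matrix_mult invertible_mult)
  have "frac_matrix M p s ** C ** (matrix_inv C ** frac_matrix M s p)
      = frac_matrix M p s ** (C ** matrix_inv C) ** frac_matrix M s p"
    by (simp add: matrix_mul_assoc)
  then have 1: "frac_matrix M p s ** C ** (matrix_inv C ** frac_matrix M s p) = mat 1"
    using assms * by (simp add: matrix_inv_right)
  have "matrix_inv C ** frac_matrix M s p ** (frac_matrix M p s ** C)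
      = matrix_inv C ** (frac_matrix M s p ** frac_matrix M p s) ** C"
    by (simp add: matrix_mul_assoc)
  then have 2: "matrix_inv C ** frac_matrix M s p ** (frac_matrix M p s ** C) = mat 1"
    using assms * by (simp add: matrix_inv_left)
  show "invertible (frac_matrix M p s ** C)"
    unfolding invertible_def using 1 2 by blast
  show "matrix_inv (frac_matrix M p s ** C) = matrix_inv C ** frac_matrix M s p"
    using 1 2 by (rule matrix_inv_unique)
qed

text \<open>One step of the iteration in fraction form. \<open>D\<close> is (p t + q s) / (s t)
  times \<open>C\<close>; in the triple product its inverse cancels one \<open>C\<close> and the
  denominator s t. Both orders agree because fractions in \<open>M\<close> commute.\<close>

lemma
  fixes M C :: "'a::comm_ring_1^'n^'n"
  assumes C: "invertible C"
    and s: "invertible (poly_matrix M s)" and t: "invertible (poly_matrix M t)"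
    and w: "invertible (poly_matrix M (p * t + q * s))"
  defines "D \<equiv> frac_matrix M p s ** C + frac_matrix M q t ** C"
  shows invertible_frac_sum: "invertible D"
    and frac_matrix_combine:
      "frac_matrix M u s ** C ** matrix_inv D ** (frac_matrix M v t ** C)
        = frac_matrix M (u * v) (p * t + q * s) ** C"
      "frac_matrix M v t ** C ** matrix_inv D ** (frac_matrix M u s ** C)
        = frac_matrix M (u * v) (p * t + q * s) ** C"
proof -
  let ?w = "p * t + q * s"
  have st: "invertible (poly_matrix M (s * t))"
    using s t by (simp add: poly_matrix_mult invertible_mult)
  have D: "D = frac_matrix M ?w (s * t) ** C"
    unfolding D_def by (simp add: frac_matrix_add s t flip: matrix_add_rdistrib)
  show "invertible D"
    unfolding D by (intro invertible_frac_matrix_mult w st C)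
  have inv: "matrix_inv D = matrix_inv C ** frac_matrix M (s * t) ?w"
    unfolding D by (intro matrix_inv_frac_matrix_mult w st C)
  have *: "X ** C ** matrix_inv D ** (Y ** C) = X ** frac_matrix M (s * t) ?w ** Y ** C" for X Y
  proof -
    have "X ** C ** matrix_inv D ** (Y ** C)
        = X ** (C ** matrix_inv C) ** frac_matrix M (s * t) ?w ** Y ** C"
      unfolding inv by (simp add: matrix_mul_assoc)
    then show ?thesis by (simp add: C matrix_inv_right)
  qed
  have "frac_matrix M u s ** frac_matrix M (s * t) ?w ** frac_matrix M v t
      = frac_matrix M ((u * v) * (s * t)) (?w * (s * t))"
    using s t w by (simp add: frac_matrix_mult poly_matrix_mult invertible_mult ac_simps)
  also have "\<dots> = frac_matrix M (u * v) ?w"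
    using w st by (rule frac_matrix_cancel)
  finally show "frac_matrix M u s ** C ** matrix_inv D ** (frac_matrix M v t ** C)
      = frac_matrix M (u * v) ?w ** C"
    by (simp only: *)
  have "frac_matrix M v t ** frac_matrix M (s * t) ?w ** frac_matrix M u s
      = frac_matrix M ((u * v) * (s * t)) (?w * (s * t))"
    using s t w by (simp add: frac_matrix_mult poly_matrix_mult invertible_mult ac_simps)
  also have "\<dots> = frac_matrix M (u * v) ?w"
    using w st by (rule frac_matrix_cancel)
  finally show "frac_matrix M v t ** C ** matrix_inv D ** (frac_matrix M u s ** C)
      = frac_matrix M (u * v) ?w ** C"
    by (simp only: *)
qed

section \<open>The iteration on pencils\<close>

lemma pencil_at_eq: "pencil_at A B \<mu> = A - mat \<mu> ** B"
  by (simp add: pencil_at_def mat_matrix_mult)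

text \<open>With C the pencil at \<open>\<mu>\<close>, the polynomials \<open>[:1, \<mu>:]\<close>
  and \<open>[:0, 1:]\<close> take the values A C^(-1) and B C^(-1) at the matrix B C^(-1).\<close>

lemma invertible_hom_geometric_sum_pencil:
  fixes A B :: "complex^'n^'n"
  assumes C: "invertible (pencil_at A B \<mu>)"
    and spectrum: "\<And>\<omega>. \<omega> \<in> S_inf \<Longrightarrow> invertible (pencil_at A B \<omega>)"
    and "n > 0"
  shows "invertible (poly_matrix (B ** matrix_inv (pencil_at A B \<mu>))
    (hom_geometric_sum [:1, \<mu>:] [:0, 1:] n))"
proof (rule invertible_poly_matrix)
  let ?C = "pencil_at A B \<mu>" and ?s = "hom_geometric_sum [:1, \<mu>:] [:0, 1:] n"
  let ?Q = "B ** matrix_inv ?C"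
  \<comment> \<open>The value 1 at z = 0 shows both that the polynomial is nonzero and that its
    roots are nonzero, which permits division by z below.\<close>
  have "hom_geometric_sum 1 (0::complex) (Suc m) = 1" for m
    by (simp add: hom_geometric_sum_Suc)
  then have at_0: "poly ?s 0 = 1"
    using gr0_implies_Suc[OF \<open>n > 0\<close>] by (auto simp: poly_hom_geometric_sum)
  then show "?s \<noteq> 0" by auto
  fix z assume z: "poly ?s z = 0"
  then have "z \<noteq> 0" using at_0 by auto
  then obtain \<omega> where \<omega>: "1 + \<mu> * z = \<omega> * z" "\<omega> ^ n = 1" "\<omega> \<noteq> 1"
    using hom_geometric_sum_eq_0_imp[of "1 + \<mu> * z" z n] z \<open>n > 0\<close>
    by (auto simp: poly_hom_geometric_sum mult.commute)
  \<comment> \<open>The choice of \<open>\<omega>\<close> says 1 + (\<open>\<mu>\<close> -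
    \<open>\<omega>\<close>) z = 0, so z is the root of this linear polynomial.\<close>
  have eq: "[:1, \<mu> - \<omega>:] = smult (- 1 / z) [:- z, 1:]"
    using \<omega>(1) \<open>z \<noteq> 0\<close> by (simp add: field_simps)
  have "pencil_at A B \<omega> = ?C + mat (\<mu> - \<omega>) ** B"
    by (simp add: pencil_at_def mat_matrix_mult vec_eq_iff algebra_simps)
  then have "pencil_at A B \<omega> ** matrix_inv ?C = mat 1 + mat (\<mu> - \<omega>) ** ?Q"
    by (simp add: matrix_add_rdistrib C matrix_inv_right matrix_mul_assoc)
  also have "\<dots> = poly_matrix ?Q [:1, \<mu> - \<omega>:]"
    by (simp add: poly_matrix_pCons mat_matrix_mult_commute[of _ ?Q])
  also have "\<dots> = mat (- 1 / z) ** poly_matrix ?Q [:- z, 1:]"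
    unfolding eq by (rule poly_matrix_smult)
  finally have "mat (- z) ** (pencil_at A B \<omega> ** matrix_inv ?C)
      = mat (- z) ** mat (- 1 / z) ** poly_matrix ?Q [:- z, 1:]"
    by (simp add: matrix_mul_assoc)
  then have "poly_matrix ?Q [:- z, 1:] = mat (- z) ** (pencil_at A B \<omega> ** matrix_inv ?C)"
    using \<open>z \<noteq> 0\<close> by (simp flip: mat_mult)
  moreover have "invertible (matrix_inv ?C)"
    using C matrix_inv_left matrix_inv_right invertible_def by blast
  ultimately show "invertible (poly_matrix ?Q [:- z, 1:])"
    using spectrum[OF root_of_unity_in_S_inf[OF \<omega>(2,3) \<open>n > 0\<close>]] \<open>z \<noteq> 0\<close>
    by (simp add: invertible_mult invertible_mat)
qed

text \<open>Since \<open>matrix_inv\<close> is total, invertibility is part of the conclusion; its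
  case i = 1 covers every inverse in the iteration.\<close>

theorem theorem2p3:
  fixes A B :: "nat \<Rightarrow> complex^'n^'n"
    and i j :: nat
  assumes regular: "regular_pencil (A 1) (B 1)"
    and spectrum: "Some ` S_inf \<inter> pencil_eigenvalues (A 1) (B 1) = {}"
    and iter_A: "\<And>k. k \<ge> 2 \<Longrightarrow> A k = A 1 ** matrix_inv (A 1 + B (k - 1)) ** A (k - 1)"
    and iter_B: "\<And>k. k \<ge> 2 \<Longrightarrow> B k = B (k - 1) ** matrix_inv (A 1 + B (k - 1)) ** B 1"
    and i: "i \<ge> 1" and j: "j \<ge> 1"
  shows "invertible (A i + B j)
    \<and> A (i + j) = A i ** matrix_inv (A i + B j) ** A j
    \<and> B (i + j) = B j ** matrix_inv (A i + B j) ** B i"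
proof -
  obtain \<mu> where "det (pencil_at (A 1) (B 1) \<mu>) \<noteq> 0"
    using regular unfolding regular_pencil_def by blast
  define C where "C = pencil_at (A 1) (B 1) \<mu>"
  have C: "invertible C"
    using \<open>det _ \<noteq> 0\<close> by (simp add: C_def invertible_det_nz)
  define M where "M = B 1 ** matrix_inv C"
  define P Q where "P = [:1, \<mu>:]" and "Q = [:0, 1 :: complex:]"
  define s where "s = hom_geometric_sum P Q"
  have "invertible (pencil_at (A 1) (B 1) \<omega>)" if "\<omega> \<in> S_inf" for \<omega>
    using spectrum that by (auto simp: pencil_eigenvalues_def invertible_det_nz)
  then have s_inv: "invertible (poly_matrix M (s n))" if "n > 0" for n
    unfolding M_def C_def s_def P_def Q_def
    using that C by (intro invertible_hom_geometric_sum_pencil) (simp_all add: C_def)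
  have s_add: "s (m + n) = P ^ m * s n + Q ^ n * s m" for m n
    unfolding s_def by (rule hom_geometric_sum_add)
  \<comment> \<open>The numerators u and v remain free: powers of \<open>P\<close> yield the formula
    for \<open>A\<close>, powers of \<open>Q\<close> the one for \<open>B\<close>. By
    \<open>s_add\<close> the combined denominator is \<open>s (m + n)\<close>.\<close>
  have combine:
    "invertible (frac_matrix M (P ^ m) (s m) ** C + frac_matrix M (Q ^ n) (s n) ** C)"
    "frac_matrix M u (s m) ** C
        ** matrix_inv (frac_matrix M (P ^ m) (s m) ** C + frac_matrix M (Q ^ n) (s n) ** C)
        ** (frac_matrix M v (s n) ** C) = frac_matrix M (u * v) (s (m + n)) ** C"
    "frac_matrix M v (s n) ** C
        ** matrix_inv (frac_matrix M (P ^ m) (s m) ** C + frac_matrix M (Q ^ n) (s n) ** C)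
        ** (frac_matrix M u (s m) ** C) = frac_matrix M (u * v) (s (m + n)) ** C"
    if "m > 0" "n > 0" for m n u v
    using that s_inv[of m] s_inv[of n] s_inv[of "m + n"] C
    by (simp_all add: s_add invertible_frac_sum frac_matrix_combine)
  have "matrix_inv (mat 1 :: complex^'n^'n) = mat 1"
    by (rule matrix_inv_unique) simp_all
  \<comment> \<open>As \<open>s 1\<close> is the constant 1, these fractions are plain polynomials
    in \<open>M\<close>.\<close>
  then have frac_1: "frac_matrix M p (s 1) = poly_matrix M p" for p
    by (simp add: frac_matrix_def s_def)
  have MC: "M ** C = B 1"
    by (simp add: M_def C matrix_inv_left flip: matrix_mul_assoc)
  have "poly_matrix M P ** C = C + mat \<mu> ** B 1"
    by (simp add: P_def poly_matrix_pCons matrix_add_rdistrib MC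
        mat_matrix_mult_commute[of \<mu> M, symmetric] flip: matrix_mul_assoc)
  then have A1: "A 1 = frac_matrix M (P ^ 1) (s 1) ** C"
    unfolding frac_1 by (simp add: C_def pencil_at_eq)
  have B1: "B 1 = frac_matrix M (Q ^ 1) (s 1) ** C"
    unfolding frac_1 using MC
    by (simp add: Q_def poly_matrix_pCons mat_0)
  have closed_form: "A k = frac_matrix M (P ^ k) (s k) ** C \<and> B k = frac_matrix M (Q ^ k) (s k) ** C"
    if "k \<ge> 1" for k
    using that
  proof (induction k rule: nat_induct_at_least)
    case base
    then show ?case using A1 B1 by simp
  next
    case (Suc k)
    then show ?case
      \<comment> \<open>The iteration is the case m = 1, n = k. In \<open>combine(3)\<close> the
        variable v occurs before u, so \<open>Q ^ k\<close> instantiates v.\<close>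
      using iter_A[of "Suc k"] iter_B[of "Suc k"] A1 B1
        combine(2)[of 1 k "P ^ 1" "P ^ k"] combine(3)[of 1 k "Q ^ k" "Q ^ 1"]
      by (simp add: mult.commute)
  qed
  show ?thesis
    \<comment> \<open>The same combination with m = i and n = j; \<open>power_add\<close> merges the
      numerators.\<close>
    using closed_form[OF i] closed_form[OF j] closed_form[of "i + j"] combine[of i j] i j
    by (simp add: power_add)
qed

end
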